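(* For every $n\in\mathbb{N}$ and $s\in\mathbb{Z}$, $$\sum_{\substack{a=1\\ (a,n)=1}}^n c_n(a-s)\, e(a/n) = \sum_{\substack{d\delta=n\\ (d,\delta s)=1}} d\,\mu^2(\delta)\, e(\delta\delta'/n),$$ where the sum on the right is over $d,\delta\in\mathbb{N}$ and, for each pair $(d,\delta)$ occurring in it, $\delta'\in\mathbb{Z}$ is any integer such that $\delta\delta'\equiv s\pmod d$.
   Context: $\mathbb{N}=\{1,2,\ldots\}$; $(a,b)$ is the greatest common divisor of $a,b\in\mathbb{Z}$; $\mu$ is the Möbius function; $e(x)=e^{2\pi i x}$ for $x\in\mathbb{R}$; $c_n(k)=\sum_{1\le a\le n,\,(a,n)=1} e(ak/n)$ is Ramanujan's sum ($n\in\mathbb{N}$, $k\in\mathbb{Z}$). *)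

theory Defs
  imports Complex_Main "HOL-Number_Theory.Number_Theory" "HOL-Computational_Algebra.Squarefree"
begin

definition add_char :: "real \<Rightarrow> complex" where
  "add_char x = exp (2 * of_real pi * \<i> * of_real x)"

definition moebius_mu :: "nat \<Rightarrow> int" where
  "moebius_mu n = (if squarefree n then (-1) ^ card (prime_factors n) else 0)"

definition ramanujan_sum :: "nat \<Rightarrow> int \<Rightarrow> complex" where
  "ramanujan_sum n k =
     (\<Sum>a | a \<in> {1..n} \<and> coprime a n. add_char (of_int (int a * k) / of_nat n))"

end

theory Submission
  imports Defs
begin

text \<open>
  Moebius inversion of the coprimality condition gives the classical formula
  \<open>c\<^sub>n(k) = (\<Sum>d\<delta> = n, d | k. d \<mu>(\<delta>))\<close> (\<open>ramanujan_sum_conv_moebius_mu\<close>). Inserting it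
  with \<open>k = a - s\<close> and exchanging the sums turns the left-hand side into
  \<open>\<Sum>d\<delta> = n. d \<mu>(\<delta>) T(d, \<delta>)\<close>, where \<open>T(d, \<delta>)\<close> is the sum of \<open>e(a/n)\<close> over the reduced
  residues \<open>a\<close> modulo \<open>n\<close> with \<open>a \<equiv> s (mod d)\<close> (\<open>reduced_class_sum\<close>).

  These inner sums can be evaluated one at a time. If \<open>d\<close> and \<open>s\<close> have a common factor,
  there is no such \<open>a\<close>. If a prime \<open>p\<close> divides both \<open>d\<close> and \<open>\<delta>\<close>, then \<open>a \<mapsto> a + n/p\<close>
  permutes the range of summation, since \<open>n/p\<close> is a multiple of \<open>d\<close> and of every prime divisor
  of \<open>n\<close>; hence \<open>T = e(1/p) T\<close> and \<open>T = 0\<close>. What remains is exactly the condition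
  \<open>(d, \<delta>s) = 1\<close>. In that case the substitution \<open>a = \<delta>\<delta>' + d x\<close> makes \<open>x\<close> run over the reduced
  residues modulo \<open>\<delta>\<close>, so \<open>T = e(\<delta>\<delta>'/n) c\<^sub>\<delta>(1) = e(\<delta>\<delta>'/n) \<mu>(\<delta>)\<close>. This second factor
  \<open>\<mu>(\<delta>)\<close> produces the square in the theorem.
\<close>

section \<open>Periodic functions on the integers\<close>

text \<open>
  All changes of variable below are instances of this one: \<open>d = 1\<close> is invariance of a sum over
  a period under translation, \<open>r = 0\<close> restricts to multiples of \<open>d\<close>, and general \<open>r\<close>
  parametrises a residue class from any representative. Periodicity absorbs the reduction of
  \<open>r + d x\<close> modulo \<open>d \<delta>\<close>.
\<close>
lemma sum_residue_class:
  fixes f :: "int \<Rightarrow> 'a :: comm_monoid_add"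
  assumes "d \<ge> 1" "\<delta> \<ge> 1"
    and periodic: "\<And>a b. [a = b] (mod d * \<delta>) \<Longrightarrow> f a = f b"
  shows "(\<Sum>a | a \<in> {0..<d * \<delta>} \<and> [a = r] (mod d). f a) = (\<Sum>x\<in>{0..<\<delta>}. f (r + d * x))"
proof (rule sum.reindex_bij_witness[where i = "\<lambda>x. (r + d * x) mod (d * \<delta>)"
        and j = "\<lambda>a. ((a - r) div d) mod \<delta>"])
  fix a assume "a \<in> {a. a \<in> {0..<d * \<delta>} \<and> [a = r] (mod d)}"
  then have a: "0 \<le> a" "a < d * \<delta>" "d dvd a - r" by (auto simp: cong_iff_dvd_diff)
  from a(3) obtain q where q: "a = r + d * q" by (metis dvdE diff_add_cancel add.commute)
  then have div: "(a - r) div d = q" using assms by simp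
  have "[r + d * (q mod \<delta>) = a] (mod d * \<delta>)"
  proof -
    have "[d * (q mod \<delta>) = d * q] (mod d * \<delta>)"
      by (intro cong_cmult_leftI cong_mod_leftI cong_refl)
    then show ?thesis unfolding q by (rule cong_add[OF cong_refl])
  qed
  then show "f (r + d * (((a - r) div d) mod \<delta>)) = f a"
    and "(r + d * (((a - r) div d) mod \<delta>)) mod (d * \<delta>) = a"
    using a periodic unfolding div by (auto simp: cong_def)
  show "((a - r) div d) mod \<delta> \<in> {0..<\<delta>}" using assms by simp
next
  have pos: "d * \<delta> > 0" using assms by simp
  fix x assume x: "x \<in> {0..<\<delta>}"
  define q where "q = (r + d * x) div (d * \<delta>)"
  have eq: "(r + d * x) mod (d * \<delta>) = r + d * (x - \<delta> * q)"
    unfolding q_def by (simp only: minus_mult_div_eq_mod[symmetric]) (simp add: algebra_simps)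
  have "(x - \<delta> * q) mod \<delta> = x" using x mod_diff_right_eq[of x "\<delta> * q" \<delta>] by simp
  then show "((r + d * x) mod (d * \<delta>) - r) div d mod \<delta> = x"
    unfolding eq using assms by simp
  show "(r + d * x) mod (d * \<delta>) \<in> {a. a \<in> {0..<d * \<delta>} \<and> [a = r] (mod d)}"
    using pos unfolding mem_Collect_eq eq[symmetric]
    by (auto simp: cong_def mod_mod_cancel)
qed

lemma sum_period_shift:
  fixes f :: "int \<Rightarrow> 'a :: comm_monoid_add"
  assumes "n \<ge> 1" "\<And>a b. [a = b] (mod n) \<Longrightarrow> f a = f b"
  shows "(\<Sum>x\<in>{0..<n}. f (x + c)) = (\<Sum>x\<in>{0..<n}. f x)"
proof -
  have "(\<Sum>a | a \<in> {0..<1 * n} \<and> [a = c] (mod 1). f a) = (\<Sum>x\<in>{0..<n}. f (c + 1 * x))"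
    by (rule sum_residue_class) (use assms in auto)
  moreover have "{a. a \<in> {0..<1 * n} \<and> [a = c] (mod 1)} = {0..<n}" by auto
  ultimately show ?thesis by (simp add: add.commute)
qed

text \<open>
  Writing the coprimality condition as an integrand keeps the range of summation a full period,
  to which the translation and residue class lemmas apply.
\<close>
lemma sum_coprime_residues:
  fixes f :: "int \<Rightarrow> 'a :: comm_monoid_add"
  assumes "n \<ge> 1" and periodic: "\<And>a b. [a = b] (mod int n) \<Longrightarrow> f a = f b"
  shows "(\<Sum>a | a \<in> {1..n} \<and> coprime a n. f (int a))
       = (\<Sum>a\<in>{0..<int n}. if coprime a (int n) then f a else 0)"
proof -
  let ?g = "\<lambda>a. if coprime a (int n) then f a else 0"
  have "(\<Sum>a | a \<in> {1..n} \<and> coprime a n. f (int a)) = (\<Sum>a\<in>{1..n}. ?g (int a))"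
    by (subst sum.inter_filter[symmetric]) simp_all
  also have "\<dots> = (\<Sum>x\<in>{0..<int n}. ?g (x + 1))"
    by (rule sum.reindex_bij_witness[where i = "\<lambda>x. nat (x + 1)" and j = "\<lambda>a. int a - 1"]) auto
  also have "\<dots> = (\<Sum>x\<in>{0..<int n}. ?g x)"
    by (rule sum_period_shift)
      (use assms in \<open>auto dest: cong_imp_coprime cong_imp_coprime[OF cong_sym] intro: periodic\<close>)
  finally show ?thesis .
qed

section \<open>Additive characters\<close>

lemma add_char_add: "add_char (x + y) = add_char x * add_char y"
  by (simp add: add_char_def exp_add[symmetric] algebra_simps)

lemma add_char_cis: "add_char x = cis (2 * pi * x)"
  by (simp add: add_char_def cis_conv_exp mult_ac)

lemma add_char_eq_1_iff: "add_char x = 1 \<longleftrightarrow> x \<in> \<int>"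
proof
  assume "add_char x = 1"
  then have "cos (2 * pi * x) = 1" by (simp add: add_char_cis complex_eq_iff)
  then obtain m :: int where "2 * pi * x = m * 2 * pi" by (auto simp: cos_one_2pi_int)
  then have "x = m" by simp
  then show "x \<in> \<int>" by simp
next
  assume "x \<in> \<int>"
  then show "add_char x = 1" by (auto simp: add_char_cis elim!: Ints_cases)
qed

lemma add_char_frac_eq_1_iff:
  assumes "n \<ge> 1"
  shows "add_char (of_int k / of_nat n) = 1 \<longleftrightarrow> int n dvd k"
proof -
  have "of_int k / real n \<in> \<int> \<longleftrightarrow> int n dvd k"
    using of_int_div_of_int_in_Ints_iff[of k "int n", where ?'a = real] assms by simp
  then show ?thesis by (simp add: add_char_eq_1_iff)
qed

lemma add_char_cong:
  assumes "n \<ge> 1" "[a = b] (mod int n)"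
  shows "add_char (of_int a / of_nat n) = add_char (of_int b / of_nat n)"
proof -
  have "add_char (of_int (a - b) / of_nat n) = 1"
    using assms by (simp only: add_char_frac_eq_1_iff cong_iff_dvd_diff)
  then show ?thesis
    using add_char_add[of "of_int (a - b) / of_nat n" "of_int b / of_nat n"]
    by (simp add: diff_divide_distrib)
qed

text \<open>
  Orthogonality: unless \<open>d\<close> divides \<open>k\<close>, translating by \<open>1\<close> multiplies the sum by
  \<open>e(k/d) \<noteq> 1\<close> without changing it.
\<close>
lemma sum_add_char:
  assumes "d \<ge> 1"
  shows "(\<Sum>x\<in>{0..<int d}. add_char (of_int (x * k) / of_nat d)) = (if int d dvd k then of_nat d else 0)"
proof (cases "int d dvd k")
  case True
  then have "add_char (of_int (x * k) / of_nat d) = 1" for x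
    using assms add_char_frac_eq_1_iff dvd_mult by blast
  then show ?thesis using True by simp
next
  case False
  let ?S = "\<Sum>x\<in>{0..<int d}. add_char (of_int (x * k) / of_nat d)"
  have "?S = (\<Sum>x\<in>{0..<int d}. add_char (of_int ((x + 1) * k) / of_nat d))"
    by (rule sum_period_shift[symmetric]) (use assms in \<open>auto intro!: add_char_cong cong_mult simp del: of_int_mult\<close>)
  also have "\<dots> = add_char (of_int k / of_nat d) * ?S"
    unfolding sum_distrib_left add_char_add[symmetric]
    by (simp add: algebra_simps add_divide_distrib)
  finally have "(add_char (of_int k / of_nat d) - 1) * ?S = 0" by (simp add: algebra_simps)
  then show ?thesis using False assms add_char_frac_eq_1_iff by simp
qed

section \<open>Moebius function and Ramanujan sums\<close>

lemma moebius_mu_prime_mult: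
  assumes "prime p" "\<not> p dvd e"
  shows "moebius_mu (p * e) = - moebius_mu e"
proof (cases "squarefree e")
  case True
  have e: "e \<noteq> 0" using assms by (metis dvd_0_right)
  have "prime_factors (p * e) = insert p (prime_factors e)"
    using assms e by (simp add: prime_factors_product prime_prime_factors prime_gt_0_nat)
  moreover have "p \<notin> prime_factors e" using assms by auto
  moreover have "squarefree (p * e)"
    using assms True by (simp add: squarefree_mult_coprime prime_imp_coprime squarefree_prime)
  ultimately show ?thesis using True by (simp add: moebius_mu_def)
next
  case False
  then show ?thesis using squarefree_multD by (auto simp: moebius_mu_def)
qed

text \<open>
  For a prime \<open>p\<close> dividing \<open>m\<close>, removing or inserting the factor \<open>p\<close> is an involution of the
  squarefree divisors of \<open>m\<close> that reverses the sign of \<open>\<mu>\<close>, so everything cancels.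
\<close>
lemma sum_moebius_mu_divisors:
  assumes "m \<ge> 1"
  shows "(\<Sum>e | e dvd m. moebius_mu e) = (if m = 1 then 1 else 0)"
proof (cases "m = 1")
  case True
  then show ?thesis by (simp add: moebius_mu_def)
next
  case False
  then obtain p where p: "prime p" "p dvd m" using prime_factor_nat by blast
  let ?D = "{e. e dvd m \<and> squarefree e}"
  let ?f = "\<lambda>e. if p dvd e then e div p else p * e"
  have fin: "finite {e. e dvd m}" using assms by simp
  have p0: "p > 0" using p by (simp add: prime_gt_0_nat)
  have sq: "\<not> p dvd e div p" if "squarefree e" "p dvd e" for e
  proof
    assume "p dvd e div p"
    then have "p * p dvd e" using that p0 by (metis dvd_div_mult_self mult_dvd_mono dvd_refl)
    then have "is_unit p" using that squarefreeD[of e p] by (simp add: power2_eq_square)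
    then show False using p by simp
  qed
  have eq: "(\<Sum>e | e dvd m. moebius_mu e) = (\<Sum>e\<in>?D. moebius_mu e)"
    by (rule sum.mono_neutral_right[OF fin]) (auto simp: moebius_mu_def)
  have f_in: "?f e \<in> ?D" if "e dvd m" "squarefree e" for e
  proof (cases "p dvd e")
    case True
    then have "e div p dvd e" by (metis dvd_div_mult_self dvd_triv_left)
    then show ?thesis using True that squarefree_mono by (auto intro: dvd_trans)
  next
    case False
    then have "coprime p e" using p by (simp add: prime_imp_coprime)
    then show ?thesis using False that p
      by (simp add: divides_mult squarefree_mult_coprime squarefree_prime)
  qed
  have involution: "?f (?f e) = e" if "e \<in> ?D" for e
    using that sq[of e] p0 by auto
  have "(\<Sum>e\<in>?D. moebius_mu e) = (\<Sum>e\<in>?D. - moebius_mu e)"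
  proof (intro sum.reindex_bij_witness[where i = ?f and j = ?f] involution)
    fix e assume "e \<in> ?D"
    then have e: "e dvd m" "squarefree e" by auto
    show "?f e \<in> ?D" by (rule f_in[OF e])
    then show "?f e \<in> ?D" .
    show "- moebius_mu (?f e) = moebius_mu e"
    proof (cases "p dvd e")
      case True
      then show ?thesis using moebius_mu_prime_mult[OF p(1) sq[OF e(2) True]] by simp
    next
      case False
      then show ?thesis using moebius_mu_prime_mult[OF p(1) False] by simp
    qed
  qed
  also have "\<dots> = - (\<Sum>e\<in>?D. moebius_mu e)" by (simp add: sum_negf)
  finally show ?thesis using False eq by simp
qed

lemma finite_factorisations:
  assumes "n \<ge> 1"
  shows "finite {(d, \<delta>). d * \<delta> = (n :: nat)}"
proof (rule finite_subset)
  show "{(d, \<delta>). d * \<delta> = n} \<subseteq> {..n} \<times> {..n}" using assms by auto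
qed simp

text \<open>
  The divisor sum of \<open>\<mu>\<close> at \<open>gcd a n\<close>, indexed by factorisations of \<open>n\<close> so that it can be
  substituted for the coprimality condition in \<open>c\<^sub>n\<close>.
\<close>
lemma sum_moebius_mu_coprime:
  assumes "n \<ge> 1"
  shows "(\<Sum>(d, \<delta>) | d * \<delta> = n. if int \<delta> dvd a then moebius_mu \<delta> else 0)
       = (if coprime a (int n) then 1 else 0)"
proof -
  let ?g = "nat (gcd a (int n))"
  have g: "?g \<ge> 1" using assms by (simp add: Suc_le_eq)
  have dvd_g: "\<delta> dvd ?g \<longleftrightarrow> \<delta> dvd n \<and> int \<delta> dvd a" for \<delta>
  proof -
    have "\<delta> dvd ?g \<longleftrightarrow> int \<delta> dvd gcd a (int n)"
      by (metis gcd_ge_0_int int_dvd_int_iff int_nat_eq)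
    then show ?thesis by auto
  qed
  have "(\<Sum>(d, \<delta>) | d * \<delta> = n. if int \<delta> dvd a then moebius_mu \<delta> else 0)
      = (\<Sum>(d, \<delta>) | d * \<delta> = n \<and> int \<delta> dvd a. moebius_mu \<delta>)"
    using finite_factorisations[OF assms]
    by (intro sum.mono_neutral_cong_right) (auto split: if_splits)
  also have "\<dots> = (\<Sum>\<delta> | \<delta> dvd ?g. moebius_mu \<delta>)"
    by (rule sum.reindex_bij_witness[where i = "\<lambda>\<delta>. (n div \<delta>, \<delta>)" and j = snd])
      (use assms in \<open>auto simp: dvd_g\<close>)
  also have "\<dots> = (if coprime a (int n) then 1 else 0)"
    using sum_moebius_mu_divisors[OF g] by (auto simp: coprime_iff_gcd_eq_1)
  finally show ?thesis .
qed

lemma ramanujan_sum_residues: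
  assumes "n \<ge> 1"
  shows "ramanujan_sum n k
    = (\<Sum>a\<in>{0..<int n}. if coprime a (int n) then add_char (of_int (a * k) / of_nat n) else 0)"
  unfolding ramanujan_sum_def
  by (rule sum_coprime_residues[OF assms])
    (auto intro!: add_char_cong[OF assms] cong_mult simp del: of_int_mult)

text \<open>
  After the coprimality condition is expanded, the term for \<open>\<delta>\<close> sums \<open>e(ak/n)\<close> over
  the multiples \<open>a = \<delta> x\<close>, which is a complete character sum modulo \<open>d = n/\<delta>\<close>.
\<close>
lemma ramanujan_sum_conv_moebius_mu:
  assumes "n \<ge> 1"
  shows "ramanujan_sum n k
    = (\<Sum>(d, \<delta>) | d * \<delta> = n. of_int (moebius_mu \<delta>) * (if int d dvd k then of_nat d else 0))"
proof -
  let ?e = "\<lambda>a. add_char (of_int (a * k) / of_nat n)"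
  have "ramanujan_sum n k = (\<Sum>a\<in>{0..<int n}. (if coprime a (int n) then ?e a else 0))"
    by (rule ramanujan_sum_residues[OF assms])
  also have "\<dots> = (\<Sum>a\<in>{0..<int n}.
      of_int (\<Sum>(d, \<delta>) | d * \<delta> = n. if int \<delta> dvd a then moebius_mu \<delta> else 0) * ?e a)"
    by (intro sum.cong refl) (simp add: sum_moebius_mu_coprime[OF assms])
  also have "\<dots> = (\<Sum>a\<in>{0..<int n}. \<Sum>(d, \<delta>) | d * \<delta> = n.
      of_int (moebius_mu \<delta>) * (if int \<delta> dvd a then ?e a else 0))"
    unfolding of_int_sum sum_distrib_right by (intro sum.cong refl) auto
  also have "\<dots> = (\<Sum>(d, \<delta>) | d * \<delta> = n. \<Sum>a\<in>{0..<int n}.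
      of_int (moebius_mu \<delta>) * (if int \<delta> dvd a then ?e a else 0))"
    by (subst sum.swap) (simp add: case_prod_unfold)
  also have "\<dots> = (\<Sum>(d, \<delta>) | d * \<delta> = n.
      of_int (moebius_mu \<delta>) * (if int d dvd k then of_nat d else 0))"
  proof (intro sum.cong refl, clarify)
    fix d \<delta> assume n: "n = d * \<delta>"
    then have pos: "d \<ge> 1" "\<delta> \<ge> 1" using assms by (auto simp: Suc_le_eq)
    have "(\<Sum>a\<in>{0..<int n}. if int \<delta> dvd a then ?e a else 0)
        = (\<Sum>a | a \<in> {0..<int \<delta> * int d} \<and> [a = 0] (mod int \<delta>). ?e a)"
      by (subst sum.inter_filter[symmetric]) (simp_all add: n cong_0_iff mult.commute)
    also have "\<dots> = (\<Sum>x\<in>{0..<int d}. ?e (0 + int \<delta> * x))"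
    proof (rule sum_residue_class)
      fix a b assume "[a = b] (mod int \<delta> * int d)"
      then have "[a * k = b * k] (mod int n)" by (simp add: n mult.commute cong_mult)
      then show "?e a = ?e b" by (rule add_char_cong[OF assms])
    qed (use pos in auto)
    also have "\<dots> = (\<Sum>x\<in>{0..<int d}. add_char (of_int (x * k) / of_nat d))"
      using pos by (simp add: n)
    also have "\<dots> = (if int d dvd k then of_nat d else 0)"
      by (rule sum_add_char[OF pos(1)])
    finally show "(\<Sum>a\<in>{0..<int (d * \<delta>)}. of_int (moebius_mu \<delta>) *
        (if int \<delta> dvd a then add_char (of_int (a * k) / of_nat (d * \<delta>)) else 0))
      = of_int (moebius_mu \<delta>) * (if int d dvd k then of_nat d else 0)"
      unfolding n by (simp only: sum_distrib_left[symmetric])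
  qed
  finally show ?thesis .
qed

corollary ramanujan_sum_1:
  assumes "n \<ge> 1"
  shows "ramanujan_sum n 1 = of_int (moebius_mu n)"
proof -
  have "ramanujan_sum n 1 = (\<Sum>(d, \<delta>)\<in>{(1, n)}.
      of_int (moebius_mu \<delta>) * (if int d dvd 1 then of_nat d else 0))"
    unfolding ramanujan_sum_conv_moebius_mu[OF assms] using finite_factorisations[OF assms]
    by (intro sum.mono_neutral_right) (auto split: if_splits)
  then show ?thesis by simp
qed

section \<open>Reduced residues in a residue class\<close>

definition reduced_class_sum :: "nat \<Rightarrow> nat \<Rightarrow> int \<Rightarrow> complex" where
  "reduced_class_sum d \<delta> s = (\<Sum>a | a \<in> {0..<int d * int \<delta>} \<and> [a = s] (mod int d).
     if coprime a (int d * int \<delta>) then add_char (of_int a / of_nat (d * \<delta>)) else 0)"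

lemma reduced_add_char_cong:
  assumes pos: "d \<ge> 1" "\<delta> \<ge> 1" and cong: "[a = b] (mod int d * int \<delta>)"
  shows "(if coprime a (int d * int \<delta>) then add_char (of_int a / of_nat (d * \<delta>)) else 0)
       = (if coprime b (int d * int \<delta>) then add_char (of_int b / of_nat (d * \<delta>)) else 0)"
proof -
  have "coprime a (int d * int \<delta>) \<longleftrightarrow> coprime b (int d * int \<delta>)"
    using cong cong_imp_coprime cong_sym by blast
  moreover have "add_char (of_int a / of_nat (d * \<delta>)) = add_char (of_int b / of_nat (d * \<delta>))"
    by (rule add_char_cong) (use assms in auto)
  ultimately show ?thesis by argo
qed

text \<open>
  With \<open>\<delta> = p u\<close>, the translation of \<open>a\<close> by \<open>n/p = d u\<close> becomes, in the parametrisation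
  \<open>a = s + d x\<close>, the translation of \<open>x\<close> by \<open>u\<close>; it multiplies each term by \<open>e(1/p)\<close>.
\<close>
lemma reduced_class_sum_eq_0_shift:
  assumes pos: "d \<ge> 1" "\<delta> \<ge> 1" and p: "prime p" "p dvd d" "p dvd \<delta>"
  shows "reduced_class_sum d \<delta> s = 0"
proof -
  obtain u where u: "\<delta> = p * u" using p by blast
  have p1: "p > 1" using p prime_gt_1_nat by blast
  have u0: "u > 0" using pos u by (cases u) auto
  let ?n = "d * \<delta>"
  let ?g = "\<lambda>a. if coprime a (int d * int \<delta>) then add_char (of_int a / of_nat ?n) else 0"
  note per = reduced_add_char_cong[OF pos]
  have "reduced_class_sum d \<delta> s = (\<Sum>x\<in>{0..<int \<delta>}. ?g (s + int d * x))"
    unfolding reduced_class_sum_def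
    by (rule sum_residue_class) (use pos per in auto)
  also have "\<dots> = (\<Sum>x\<in>{0..<int \<delta>}. ?g (s + int d * (x + int u)))"
  proof (rule sum_period_shift[symmetric])
    fix x y assume "[x = y] (mod int \<delta>)"
    then have "[s + int d * x = s + int d * y] (mod int d * int \<delta>)"
      by (intro cong_add cong_refl cong_cmult_leftI)
    then show "?g (s + int d * x) = ?g (s + int d * y)" by (rule per)
  qed (use pos in simp)
  also have "\<dots> = (\<Sum>x\<in>{0..<int \<delta>}. add_char (of_int 1 / of_nat p) * ?g (s + int d * x))"
  proof (intro sum.cong refl)
    fix x
    \<comment> \<open>As \<open>p\<close> divides \<open>d\<close>, the modulus \<open>d \<delta> = d u p\<close> may be replaced by the shift \<open>d u\<close> itself.\<close>
    have *: "coprime (a + int d * int u) (int d * int \<delta>) \<longleftrightarrow> coprime a (int d * int \<delta>)" for a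
    proof -
      have "coprime b (int d * int \<delta>) \<longleftrightarrow> coprime b (int d * int u)" for b
        using p(2) coprime_divisors[of b b "int p" "int d"] by (auto simp: u)
      then show ?thesis by (simp add: coprime_iff_gcd_eq_1)
    qed
    have "of_int (s + int d * (x + int u)) / real ?n = of_int 1 / real p + of_int (s + int d * x) / real ?n"
      using pos u u0 p1 by (simp add: field_simps)
    then have "add_char (of_int (s + int d * (x + int u)) / of_nat ?n)
        = add_char (of_int 1 / of_nat p) * add_char (of_int (s + int d * x) / of_nat ?n)"
      by (simp only: add_char_add)
    then show "?g (s + int d * (x + int u)) = add_char (of_int 1 / of_nat p) * ?g (s + int d * x)"
      using *[of "s + int d * x"] by (simp add: algebra_simps)
  qed
  also have "\<dots> = add_char (of_int 1 / of_nat p) * (\<Sum>x\<in>{0..<int \<delta>}. ?g (s + int d * x))"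
    by (simp add: sum_distrib_left)
  also have "(\<Sum>x\<in>{0..<int \<delta>}. ?g (s + int d * x)) = reduced_class_sum d \<delta> s"
    unfolding reduced_class_sum_def
    by (rule sum_residue_class[symmetric]) (use pos per in auto)
  finally have "(add_char (of_int 1 / of_nat p) - 1) * reduced_class_sum d \<delta> s = 0"
    by (simp add: algebra_simps)
  moreover have "add_char (of_int 1 / of_nat p) \<noteq> 1"
    using add_char_frac_eq_1_iff[of p 1] p1 by simp
  ultimately show ?thesis by simp
qed

lemma reduced_class_sum_eq_0:
  assumes pos: "d \<ge> 1" "\<delta> \<ge> 1" and nc: "\<not> coprime (int d) (int \<delta> * s)"
  shows "reduced_class_sum d \<delta> s = 0"
proof (cases "coprime (int d) s")
  case True
  then have "\<not> coprime d \<delta>" using nc by simp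
  then obtain p where "prime p" "p dvd d" "p dvd \<delta>"
    using pos by (metis coprime_iff_gcd_eq_1 gcd_dvd1 gcd_dvd2 prime_factor_nat dvd_trans)
  then show ?thesis using reduced_class_sum_eq_0_shift[OF pos] by blast
next
  case False
  then have "\<not> coprime a (int d * int \<delta>)" if "[a = s] (mod int d)" for a
    using cong_imp_coprime[OF that] by (auto simp: coprime_commute)
  then show ?thesis unfolding reduced_class_sum_def by (intro sum.neutral) auto
qed

text \<open>
  The representative \<open>\<delta> \<delta>'\<close> of the class of \<open>s\<close> modulo \<open>d\<close> is a multiple of \<open>\<delta>\<close>, so
  \<open>\<delta> \<delta>' + d x\<close> is prime to \<open>\<delta>\<close> exactly when \<open>x\<close> is; it is prime to \<open>d\<close> because \<open>s\<close> is.
\<close>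
lemma reduced_class_sum_coprime:
  assumes pos: "d \<ge> 1" "\<delta> \<ge> 1" and cop: "coprime (int d) (int \<delta> * s)"
    and \<delta>': "[int \<delta> * \<delta>' = s] (mod int d)"
  shows "reduced_class_sum d \<delta> s = of_int (moebius_mu \<delta>) * add_char (of_int (int \<delta> * \<delta>') / of_nat (d * \<delta>))"
proof -
  let ?n = "d * \<delta>" and ?r = "int \<delta> * \<delta>'"
  let ?g = "\<lambda>a. if coprime a (int d * int \<delta>) then add_char (of_int a / of_nat ?n) else 0"
  note per = reduced_add_char_cong[OF pos]
  have "reduced_class_sum d \<delta> s
      = (\<Sum>a | a \<in> {0..<int d * int \<delta>} \<and> [a = ?r] (mod int d). ?g a)"
    unfolding reduced_class_sum_def using \<delta>' by (simp add: cong_def)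
  also have "\<dots> = (\<Sum>x\<in>{0..<int \<delta>}. ?g (?r + int d * x))"
    by (rule sum_residue_class) (use pos per in auto)
  also have "\<dots> = (\<Sum>x\<in>{0..<int \<delta>}. add_char (of_int ?r / of_nat ?n) *
      (if coprime x (int \<delta>) then add_char (of_int (x * 1) / of_nat \<delta>) else 0))"
  proof (intro sum.cong refl)
    fix x
    have "coprime (?r + int d * x) (int d)"
    proof (rule cong_imp_coprime)
      show "[s = ?r + int d * x] (mod int d)" using \<delta>' by (simp add: cong_def)
      show "coprime s (int d)" using cop by (simp add: coprime_commute)
    qed
    moreover have "coprime (?r + int d * x) (int \<delta>) \<longleftrightarrow> coprime x (int \<delta>)"
    proof -
      have "coprime (?r + int d * x) (int \<delta>) \<longleftrightarrow> coprime (int d * x) (int \<delta>)"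
        using gcd_add_mult[of "int \<delta>" \<delta>' "int d * x"]
        by (simp add: coprime_iff_gcd_eq_1 gcd.commute mult.commute)
      also have "\<dots> \<longleftrightarrow> coprime x (int \<delta>)" using cop by simp
      finally show ?thesis .
    qed
    moreover have "of_int (?r + int d * x) / real ?n = of_int ?r / real ?n + of_int (x * 1) / real \<delta>"
      using pos by (simp add: field_simps)
    then have "add_char (of_int (?r + int d * x) / of_nat ?n)
        = add_char (of_int ?r / of_nat ?n) * add_char (of_int (x * 1) / of_nat \<delta>)"
      by (simp only: add_char_add)
    ultimately show "?g (?r + int d * x) = add_char (of_int ?r / of_nat ?n) *
      (if coprime x (int \<delta>) then add_char (of_int (x * 1) / of_nat \<delta>) else 0)"
      by simp
  qed
  also have "\<dots> = add_char (of_int ?r / of_nat ?n) * ramanujan_sum \<delta> 1"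
    by (simp only: sum_distrib_left[symmetric] ramanujan_sum_residues[OF pos(2)])
  finally show ?thesis using ramanujan_sum_1[OF pos(2)] by simp
qed

theorem mainTheorem7:
  fixes n :: nat and s :: int and \<delta>' :: "nat \<Rightarrow> nat \<Rightarrow> int"
  assumes "n \<ge> 1"
    and "\<And>d \<delta> :: nat. d * \<delta> = n \<Longrightarrow> coprime (int d) (int \<delta> * s)
           \<Longrightarrow> [int \<delta> * \<delta>' d \<delta> = s] (mod int d)"
  shows "(\<Sum>a | a \<in> {1..n} \<and> coprime a n.
            ramanujan_sum n (int a - s) * add_char (of_nat a / of_nat n)) =
         (\<Sum>(d, \<delta>) | d * \<delta> = n \<and> coprime (int d) (int \<delta> * s).
            of_nat d * of_int ((moebius_mu \<delta>)\<^sup>2)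
              * add_char (of_int (int \<delta> * \<delta>' d \<delta>) / of_nat n))"
proof -
  note n = assms(1)
  let ?e = "\<lambda>a. add_char (of_int a / of_nat n)"
  let ?P = "{(d, \<delta>). d * \<delta> = n}"
  have ram_cong: "ramanujan_sum n k = ramanujan_sum n l" if "[k = l] (mod int n)" for k l
    unfolding ramanujan_sum_def
    by (intro sum.cong refl add_char_cong[OF n] cong_mult cong_refl that)
  have reduced_zero: "reduced_class_sum d \<delta> s = 0"
    if "d * \<delta> = n" "\<not> coprime (int d) (int \<delta> * s)" for d \<delta>
    by (rule reduced_class_sum_eq_0) (use that n in \<open>auto simp: Suc_le_eq\<close>)
  have "(\<Sum>a | a \<in> {1..n} \<and> coprime a n.
            ramanujan_sum n (int a - s) * add_char (of_nat a / of_nat n))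
      = (\<Sum>a | a \<in> {1..n} \<and> coprime a n. ramanujan_sum n (int a - s) * ?e (int a))"
    by simp
  also have "\<dots> = (\<Sum>a\<in>{0..<int n}. if coprime a (int n) then ramanujan_sum n (a - s) * ?e a else 0)"
  proof (rule sum_coprime_residues[OF n])
    fix a b assume "[a = b] (mod int n)"
    then show "ramanujan_sum n (a - s) * ?e a = ramanujan_sum n (b - s) * ?e b"
      using ram_cong[of "a - s" "b - s"] add_char_cong[OF n, of a b] by (simp add: cong_diff)
  qed
  also have "\<dots> = (\<Sum>a\<in>{0..<int n}. \<Sum>(d, \<delta>)\<in>?P. of_nat d * of_int (moebius_mu \<delta>) *
      (if [a = s] (mod int d) then if coprime a (int n) then ?e a else 0 else 0))"
  proof (intro sum.cong refl)
    fix a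
    show "(if coprime a (int n) then ramanujan_sum n (a - s) * ?e a else 0)
      = (\<Sum>(d, \<delta>)\<in>?P. of_nat d * of_int (moebius_mu \<delta>) *
      (if [a = s] (mod int d) then if coprime a (int n) then ?e a else 0 else 0))"
      unfolding ramanujan_sum_conv_moebius_mu[OF n] sum_distrib_right
      by (auto intro!: sum.cong simp: cong_iff_dvd_diff)
  qed
  also have "\<dots> = (\<Sum>(d, \<delta>)\<in>?P. of_nat d * of_int (moebius_mu \<delta>) *
      (\<Sum>a\<in>{0..<int n}. if [a = s] (mod int d) then if coprime a (int n) then ?e a else 0 else 0))"
    by (subst sum.swap) (simp add: case_prod_unfold sum_distrib_left)
  also have "\<dots> = (\<Sum>(d, \<delta>)\<in>?P. of_nat d * of_int (moebius_mu \<delta>) * reduced_class_sum d \<delta> s)"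
  proof (intro sum.cong refl, clarify)
    fix d \<delta> assume "n = d * \<delta>"
    then show "of_nat d * of_int (moebius_mu \<delta>) * (\<Sum>a\<in>{0..<int (d * \<delta>)}.
        if [a = s] (mod int d) then if coprime a (int (d * \<delta>))
          then add_char (of_int a / of_nat (d * \<delta>)) else 0 else 0)
      = of_nat d * of_int (moebius_mu \<delta>) * reduced_class_sum d \<delta> s"
      unfolding reduced_class_sum_def by (subst sum.inter_filter[symmetric]) simp_all
  qed
  also have "\<dots> = (\<Sum>(d, \<delta>) | d * \<delta> = n \<and> coprime (int d) (int \<delta> * s).
      of_nat d * of_int (moebius_mu \<delta>) * reduced_class_sum d \<delta> s)"
  proof (rule sum.mono_neutral_right[OF finite_factorisations[OF n]])
    show "\<forall>i\<in>?P - {(d, \<delta>). d * \<delta> = n \<and> coprime (int d) (int \<delta> * s)}.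
      (case i of (d, \<delta>) \<Rightarrow> of_nat d * of_int (moebius_mu \<delta>) * reduced_class_sum d \<delta> s) = 0"
      using reduced_zero by (clarify; metis mult_zero_right)
  qed auto
  also have "\<dots> = (\<Sum>(d, \<delta>) | d * \<delta> = n \<and> coprime (int d) (int \<delta> * s).
            of_nat d * of_int ((moebius_mu \<delta>)\<^sup>2)
              * add_char (of_int (int \<delta> * \<delta>' d \<delta>) / of_nat n))"
  proof (intro sum.cong refl, clarify)
    fix d \<delta> assume *: "n = d * \<delta>" "coprime (int d) (int \<delta> * s)"
    have "reduced_class_sum d \<delta> s
        = of_int (moebius_mu \<delta>) * add_char (of_int (int \<delta> * \<delta>' d \<delta>) / of_nat (d * \<delta>))"
      by (rule reduced_class_sum_coprime) (use * n assms(2) in \<open>auto simp: Suc_le_eq\<close>)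
    then show "of_nat d * of_int (moebius_mu \<delta>) * reduced_class_sum d \<delta> s
      = of_nat d * of_int ((moebius_mu \<delta>)\<^sup>2)
        * add_char (of_int (int \<delta> * \<delta>' d \<delta>) / of_nat (d * \<delta>))"
      by (simp add: power2_eq_square)
  qed
  finally show ?thesis .
qed

end
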